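(* For every positive integer $n$, the sum $\mathrm{dsv}(n)$ of the depths of symmetric valleys over all compositions of $n$ is given by $$\mathrm{dsv}(n)=\left(\frac{-6n+7}{108}\right)(-1)^{n}+\left(\frac{21n-79}{1323}\right)2^n+\frac{(-33-15\sqrt{3}\,i)(-2)^n}{441(1+i\sqrt{3})^{n+1}}+\frac{(-33+15\sqrt{3}\,i)(-2)^n}{441(1-i\sqrt{3})^{n+1}}+\frac{1}{12},$$ where $i=\sqrt{-1}$.
   Context: A composition of a positive integer $n$ with $k$ parts is a sequence $\pi=\pi_1\pi_2\cdots\pi_k$ of positive integers with $\sum_{j=1}^k\pi_j=n$. A symmetric valley of $\pi$ is a triple of consecutive parts $\pi_j\pi_{j+1}\pi_{j+2}$ ($1\le j\le k-2$) with $\pi_j>\pi_{j+1}$ and $\pi_j=\pi_{j+2}$; its depth is $\pi_j-\pi_{j+1}$. $\mathrm{dsv}(n)$ is the sum, over all compositions $\pi$ of $n$ (with any number of parts) and all symmetric valleys of $\pi$ (one for each such position $j$), of the depths of these symmetric valleys. *)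

theory Defs
  imports Complex_Main
begin

definition compositions :: "nat \<Rightarrow> nat list set" where
  "compositions n = {p. (\<forall>x \<in> set p. 0 < x) \<and> sum_list p = n}"

(* Positions are counted from 0; a valley is recorded by the position of its first part. *)
definition symmetric_valleys :: "nat list \<Rightarrow> nat set" where
  "symmetric_valleys p = {j. j + 2 < length p \<and> p ! j > p ! (j + 1) \<and> p ! j = p ! (j + 2)}"

(* At a symmetric valley the natural-number subtraction does not truncate. *)
definition valley_depth :: "nat list \<Rightarrow> nat \<Rightarrow> nat" where
  "valley_depth p j = p ! j - p ! (j + 1)"

definition dsv :: "nat \<Rightarrow> nat" where
  "dsv n = (\<Sum>p \<in> compositions n. \<Sum>j \<in> symmetric_valleys p. valley_depth p j)"

(* The two index sets in dsv are finite, so neither sum is 0 by convention. *)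

lemma finite_symmetric_valleys: "finite (symmetric_valleys p)"
  by (rule finite_subset[of _ "{..<length p}"]) (auto simp: symmetric_valleys_def)

lemma finite_compositions: "finite (compositions n)"
proof (rule finite_subset)
  have len: "(\<forall>x \<in> set p. 0 < x) \<Longrightarrow> length p \<le> sum_list p" for p :: "nat list"
    by (induction p) (auto simp: Suc_le_eq)
  show "compositions n \<subseteq> {p. set p \<subseteq> {..n} \<and> length p \<le> n}"
    using len by (auto simp: compositions_def intro: member_le_sum_list)
  show "finite {p :: nat list. set p \<subseteq> {..n} \<and> length p \<le> n}"
    by (rule finite_lists_length_le) simp
qed

end

theory Submission
  imports Defs "HOL-Computational_Algebra.Formal_Power_Series"
begin

text \<open>The proof computes the generating function of dsv and expands it in partial fractions.

Read a composition from the left. Removing its first part $a$ leaves a composition whose symmetric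
valleys are those of the original one, except for a possible valley at the very beginning. So if
$D$, $H$ and $C$ are the generating functions of compositions weighted by the total depth, by the
depth of a valley at the beginning, and by $1$, then
$D = H + \frac{x}{1-x} D$ and likewise $C = 1 + \frac{x}{1-x} C$. A composition that begins with a
symmetric valley has the form $(d+b)\, b\, (d+b)\, q$ with $d, b \ge 1$ and $q$ an arbitrary,
possibly empty, composition; its sum is $2d + 3b + |q|$, where $|q|$ is the sum of $q$, and the
valley has depth $d$. These three data are chosen independently, hence
$$H = \frac{x^2}{(1-x^2)^2} \cdot \frac{x^3}{1-x^3} \cdot C.$$
Solving the two linear equations and cancelling $(1-x)^2$ gives (\<open>gf_dsv\<close>)
$$D = \frac{x^5}{(1+x)^2 (1-x^3) (1-2x)^2}.$$

The denominator has double roots at $-1$ and $1/2$ and simple roots at the three cube roots of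
unity. These produce the terms $(-1)^n$, $n(-1)^n$, $2^n$, $n 2^n$, the constant term, and the two
conjugate terms: with $s = \pm i \sqrt 3$, the number $-2/(1+s)$ equals $(s-1)/2$, a primitive cube
root of unity. \<open>partial_fractions\<close> verifies the decomposition after multiplication by the
common denominator $5292 = 12 \cdot 441$ of the coefficients.\<close>

section \<open>Generating functions of weighted sets\<close>

text \<open>Each coefficient of a generating function is a sum over a fibre of the weight, and a sum
over an infinite set would be zero by convention.\<close>

definition graded :: "('a \<Rightarrow> nat) \<Rightarrow> 'a set \<Rightarrow> bool" where
  "graded w A \<longleftrightarrow> (\<forall>n. finite {x \<in> A. w x = n})"

definition gf :: "('a \<Rightarrow> nat) \<Rightarrow> 'a set \<Rightarrow> ('a \<Rightarrow> 'b) \<Rightarrow> 'b::comm_ring_1 fps" where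
  "gf w A f = Abs_fps (\<lambda>n. \<Sum>x \<in> {x \<in> A. w x = n}. f x)"

lemma gf_nth: "fps_nth (gf w A f) n = (\<Sum>x \<in> {x \<in> A. w x = n}. f x)"
  by (simp add: gf_def)

lemma gf_cong: "(\<And>x. x \<in> A \<Longrightarrow> f x = g x) \<Longrightarrow> gf w A f = gf w A g"
  by (auto simp: fps_eq_iff gf_nth intro!: sum.cong)

lemma gf_add: "gf w A (\<lambda>x. f x + g x) = gf w A f + gf w A g"
  by (simp add: fps_eq_iff gf_nth sum.distrib)

lemma gf_singleton: "gf w {x} f = fps_const (f x) * fps_X ^ w x"
  by (auto simp: fps_eq_iff gf_nth fps_X_power_nth intro!: sum.neutral cong: conj_cong
        simp: Collect_conv_if2)

lemma gf_Un_disjoint: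
  assumes "graded w A" "graded w B" "A \<inter> B = {}"
  shows "gf w (A \<union> B) f = gf w A f + gf w B f"
proof (rule fps_ext)
  fix n
  have "{x \<in> A \<union> B. w x = n} = {x \<in> A. w x = n} \<union> {x \<in> B. w x = n}" by auto
  then show "fps_nth (gf w (A \<union> B) f) n = fps_nth (gf w A f + gf w B f) n"
    using assms by (simp add: gf_nth graded_def) (rule sum.union_disjoint, auto)
qed

lemma gf_image:
  assumes "inj_on h A"
  shows "gf w (h ` A) f = gf (\<lambda>x. w (h x)) A (\<lambda>x. f (h x))"
proof (rule fps_ext)
  fix n
  have "{y \<in> h ` A. w y = n} = h ` {x \<in> A. w (h x) = n}" by auto
  moreover have "inj_on h {x \<in> A. w (h x) = n}" using assms by (auto simp: inj_on_def)
  ultimately show "fps_nth (gf w (h ` A) f) n = fps_nth (gf (\<lambda>x. w (h x)) A (\<lambda>x. f (h x))) n"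
    by (simp add: gf_nth sum.reindex)
qed

lemma gf_restrict_support:
  assumes "graded w A" "B \<subseteq> A" "\<And>x. x \<in> A - B \<Longrightarrow> f x = 0"
  shows "gf w A f = gf w B f"
  using assms unfolding fps_eq_iff gf_nth graded_def
  by (intro allI sum.mono_neutral_right) auto

lemma gf_shift: "gf (\<lambda>x. c + w x) A f = fps_X ^ c * gf w A f"
proof (rule fps_ext)
  fix n
  have "{x \<in> A. c + w x = n} = (if n < c then {} else {x \<in> A. w x = n - c})" by auto
  then show "fps_nth (gf (\<lambda>x. c + w x) A f) n = fps_nth (fps_X ^ c * gf w A f) n"
    by (simp add: gf_nth fps_X_power_mult_nth)
qed

text \<open>The fibre of the sum of the weights over \<open>n\<close> is the disjoint union of the products of the fibres
over \<open>i\<close> and \<open>n - i\<close>, which is the Cauchy product.\<close>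

lemma gf_times:
  assumes "graded w A" "graded v B"
  shows "gf (\<lambda>(x, y). w x + v y) (A \<times> B) (\<lambda>(x, y). f x * g y) = gf w A f * gf v B g"
proof (rule fps_ext)
  fix n
  let ?fib = "\<lambda>i. {x \<in> A. w x = i} \<times> {y \<in> B. v y = n - i}"
  have fin: "finite (?fib i)" for i using assms by (simp add: graded_def)
  have "{p \<in> A \<times> B. (\<lambda>(x, y). w x + v y) p = n} = (\<Union>i\<in>{0..n}. ?fib i)" by auto
  then have "fps_nth (gf (\<lambda>(x, y). w x + v y) (A \<times> B) (\<lambda>(x, y). f x * g y)) n
      = (\<Sum>i = 0..n. \<Sum>(x, y)\<in>?fib i. f x * g y)"
    using fin by (simp add: gf_nth) (rule sum.UNION_disjoint, auto)
  also have "\<dots> = fps_nth (gf w A f * gf v B g) n"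
    by (simp add: fps_mult_nth gf_nth sum_product sum.cartesian_product)
  finally show "fps_nth (gf (\<lambda>(x, y). w x + v y) (A \<times> B) (\<lambda>(x, y). f x * g y)) n
      = fps_nth (gf w A f * gf v B g) n" .
qed

lemma graded_times:
  assumes "graded w A" "graded v B"
  shows "graded (\<lambda>(x, y). w x + v y) (A \<times> B)"
  unfolding graded_def
proof
  fix n
  have "{p \<in> A \<times> B. (\<lambda>(x, y). w x + v y) p = n}
      = (\<Union>i\<in>{0..n}. {x \<in> A. w x = i} \<times> {y \<in> B. v y = n - i})" by auto
  then show "finite {p \<in> A \<times> B. (\<lambda>(x, y). w x + v y) p = n}"
    using assms by (simp add: graded_def)
qed

lemma graded_subset: "graded w A \<Longrightarrow> B \<subseteq> A \<Longrightarrow> graded w B"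
  unfolding graded_def by (blast intro: rev_finite_subset)

lemma solve_affine_equation: "d = h + s * d \<Longrightarrow> (1 - s) * d = (h :: 'a::comm_ring_1)"
  by (simp add: left_diff_distrib diff_eq_eq)

text \<open>Here \<open>s\<close> is the series $x/(1-x)$ that counts the possible first parts. Both the number of
compositions and their total depth satisfy an equation of this shape.\<close>

lemma solve_first_part_equation:
  fixes d :: "'a::comm_ring_1"
  assumes "d = h + s * d" "(1 - x) * s = x"
  shows "(1 - 2 * x) * d = (1 - x) * h"
proof -
  have "(1 - x) * d = (1 - x) * h + ((1 - x) * s) * d"
    using arg_cong[OF assms(1), of "(*) (1 - x)"] by (simp only: distrib_left mult.assoc)
  then show ?thesis unfolding assms(2) by (simp add: algebra_simps)
qed

section \<open>Multiples of a fixed number\<close>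

lemma graded_multiples: "k > 0 \<Longrightarrow> graded (\<lambda>d. k * d) {0<..}"
  unfolding graded_def
  by (auto intro!: finite_subset[of "{x. 0 < x \<and> k * x = n}" "{..n}" for n])

text \<open>Either $d = 1$, or $d$ is a successor and contributes a further factor $x^k$. Since
\<open>f (Suc d)\<close> is \<open>f d\<close> again when \<open>f\<close> is constant, and \<open>f d + 1\<close> when \<open>f\<close> is the identity, this is a
linear equation for the series in these two cases.\<close>

lemma gf_multiples_rec:
  assumes "k > 0"
  shows "gf (\<lambda>d. k * d) {0<..} f
    = fps_X ^ k * (fps_const (f 1) + gf (\<lambda>d. k * d) {0<..} (\<lambda>d. f (Suc d)))"
proof -
  have split: "{0<..} = {1} \<union> Suc ` {0<..}"
  proof (rule set_eqI)
    show "x \<in> {0<..} \<longleftrightarrow> x \<in> {1} \<union> Suc ` {0<..}" for x :: nat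
      by (cases x; cases "x - 1") auto
  qed
  have "gf (\<lambda>d. k * d) {0<..} f
      = gf (\<lambda>d. k * d) {1} f + gf (\<lambda>d. k * d) (Suc ` {0<..}) f"
    by (subst split, rule gf_Un_disjoint)
      (use graded_multiples[OF assms] in \<open>auto intro: graded_subset\<close>)
  then show ?thesis
    by (simp add: gf_singleton gf_image gf_shift algebra_simps)
qed

lemma gf_multiples_count:
  assumes "k > 0"
  shows "(1 - fps_X ^ k) * gf (\<lambda>d. k * d) {0<..} (\<lambda>_. 1) = fps_X ^ k"
  using gf_multiples_rec[OF assms, of "\<lambda>_. 1"] by (simp add: algebra_simps)

lemma gf_multiples_sum:
  assumes "k > 0"
  shows "(1 - fps_X ^ k)\<^sup>2 * gf (\<lambda>d. k * d) {0<..} of_nat = fps_X ^ k"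
proof -
  let ?G = "gf (\<lambda>d. k * d) {0<..} (\<lambda>_. 1) :: 'a fps"
  let ?P = "gf (\<lambda>d. k * d) {0<..} of_nat :: 'a fps"
  have shifted: "gf (\<lambda>d. k * d) {0<..} (\<lambda>d. of_nat (Suc d)) = ?G + ?P"
    by (simp add: gf_add)
  have "?P = fps_X ^ k * (1 + ?G) + fps_X ^ k * ?P"
    by (rule trans[OF gf_multiples_rec[OF assms]], unfold shifted) (simp add: distrib_left)
  then have "(1 - fps_X ^ k) * ?P = fps_X ^ k * (1 + ?G)"
    by (rule solve_affine_equation)
  then have "(1 - fps_X ^ k)\<^sup>2 * ?P = fps_X ^ k * ((1 - fps_X ^ k) + (1 - fps_X ^ k) * ?G)"
    by (simp add: power2_eq_square mult.assoc) (simp add: algebra_simps)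
  also have "\<dots> = fps_X ^ k"
    by (simp only: gf_multiples_count[OF assms]) simp
  finally show ?thesis .
qed

section \<open>Symmetric valleys of compositions\<close>

definition pos_lists :: "nat list set" where
  "pos_lists = {p. \<forall>x \<in> set p. 0 < x}"

lemma compositions_eq: "compositions n = {p \<in> pos_lists. sum_list p = n}"
  by (simp add: compositions_def pos_lists_def)

lemma graded_pos_lists: "graded sum_list pos_lists"
  by (simp add: graded_def flip: compositions_eq add: finite_compositions)

definition total_depth :: "nat list \<Rightarrow> nat" where
  "total_depth p = (\<Sum>j \<in> symmetric_valleys p. valley_depth p j)"

text \<open>By truncated subtraction this is zero also when \<open>a = c\<close> but there is no valley because
\<open>a \<le> b\<close>.\<close>

fun initial_depth :: "nat list \<Rightarrow> nat" where
  "initial_depth (a # b # c # q) = (if a = c then a - b else 0)"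
| "initial_depth _ = 0"

lemma total_depth_Nil: "total_depth [] = 0"
  by (simp add: total_depth_def symmetric_valleys_def)

lemma initial_depth_eq:
  "initial_depth p = (if 0 \<in> symmetric_valleys p then valley_depth p 0 else 0)"
  by (cases p rule: initial_depth.cases) (auto simp: symmetric_valleys_def valley_depth_def)

text \<open>A valley of \<open>a # p\<close> either starts at position 0 or is a valley of \<open>p\<close> moved by one
position.\<close>

lemma total_depth_Cons: "total_depth (a # p) = initial_depth (a # p) + total_depth p"
proof -
  let ?V = "symmetric_valleys (a # p)"
  have Suc_iff: "Suc j \<in> ?V \<longleftrightarrow> j \<in> symmetric_valleys p" for j
    by (simp add: symmetric_valleys_def)
  have "?V = (?V \<inter> {0}) \<union> Suc ` symmetric_valleys p"
  proof (rule set_eqI)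
    show "j \<in> ?V \<longleftrightarrow> j \<in> (?V \<inter> {0}) \<union> Suc ` symmetric_valleys p" for j
      by (cases j) (auto simp: Suc_iff)
  qed
  then have "total_depth (a # p) = (\<Sum>j \<in> (?V \<inter> {0}) \<union> Suc ` symmetric_valleys p. valley_depth (a # p) j)"
    by (simp add: total_depth_def)
  also have "\<dots> = (\<Sum>j \<in> ?V \<inter> {0}. valley_depth (a # p) j)
      + (\<Sum>j \<in> Suc ` symmetric_valleys p. valley_depth (a # p) j)"
    by (rule sum.union_disjoint) (auto simp: finite_symmetric_valleys)
  also have "(\<Sum>j \<in> ?V \<inter> {0}. valley_depth (a # p) j) = initial_depth (a # p)"
    by (simp add: initial_depth_eq Int_insert_right)
  also have "(\<Sum>j \<in> Suc ` symmetric_valleys p. valley_depth (a # p) j) = total_depth p"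
    by (simp add: sum.reindex total_depth_def valley_depth_def)
  finally show ?thesis .
qed

text \<open>Decomposition by the first part: the step on which all recursions for compositions rest.\<close>

lemma gf_pos_lists_rec:
  "gf sum_list pos_lists f
    = fps_const (f []) + gf (\<lambda>(a, p). a + sum_list p) ({0<..} \<times> pos_lists) (\<lambda>(a, p). f (a # p))"
proof -
  let ?T = "(\<lambda>(a, p). a # p) ` ({0<..} \<times> pos_lists)"
  have split: "pos_lists = {[]} \<union> ?T"
  proof (rule set_eqI)
    show "p \<in> pos_lists \<longleftrightarrow> p \<in> {[]} \<union> ?T" for p
      by (cases p) (auto simp: pos_lists_def image_iff)
  qed
  have "gf sum_list pos_lists f = gf sum_list {[]} f + gf sum_list ?T f"
    by (subst split, rule gf_Un_disjoint)
      (use graded_pos_lists split in \<open>auto intro: graded_subset\<close>)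
  moreover have "inj_on (\<lambda>(a, p). a # p) ({0<..} \<times> pos_lists)" by (auto simp: inj_on_def)
  ultimately show ?thesis
    by (simp add: gf_singleton gf_image case_prod_unfold)
qed

lemma graded_positive: "graded (\<lambda>d. d) {0<..}"
  using graded_multiples[of 1] by simp

lemma gf_count_parts: "(1 - fps_X) * gf (\<lambda>d. d) {0<..} (\<lambda>_. 1) = fps_X"
  using gf_multiples_count[of 1] by simp

lemma gf_compositions:
  "(1 - 2 * fps_X) * gf sum_list pos_lists (\<lambda>_. 1) = 1 - fps_X"
proof -
  let ?C = "gf sum_list pos_lists (\<lambda>_. 1) :: 'a fps"
  let ?S = "gf (\<lambda>d. d) {0<..} (\<lambda>_. 1) :: 'a fps"
  have "?C = 1 + ?S * ?C"
    using gf_pos_lists_rec[of "\<lambda>_. 1 :: 'a"]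
      gf_times[OF graded_positive graded_pos_lists, of "\<lambda>_. 1 :: 'a" "\<lambda>_. 1"] by simp
  from solve_first_part_equation[OF this gf_count_parts] show ?thesis by simp
qed

text \<open>Only lists of the form $(d+b)\, b\, (d+b)\, q$ with positive $d$, $b$ have an initial valley. Its
depth is $d$ and the sum of the list is $2d + 3b$ plus the sum of $q$, so the generating function factors.\<close>

lemma gf_initial_depth:
  "gf sum_list pos_lists (\<lambda>p. of_nat (initial_depth p))
    = gf (\<lambda>d. 2 * d) {0<..} of_nat
      * (gf (\<lambda>b. 3 * b) {0<..} (\<lambda>_. 1) * gf sum_list pos_lists (\<lambda>_. 1))"
proof -
  let ?h = "\<lambda>(d, b, q). (d + b) # b # (d + b) # q :: nat list"
  let ?T = "{0<..} \<times> {0<..} \<times> pos_lists"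
  have inj: "inj_on ?h ?T" by (auto simp: inj_on_def)
  have sub: "?h ` ?T \<subseteq> pos_lists" by (auto simp: pos_lists_def)
  have supp: "initial_depth p = 0" if "p \<in> pos_lists - ?h ` ?T" for p
  proof (rule ccontr)
    assume "initial_depth p \<noteq> 0"
    then obtain a b q where "p = a # b # a # q" "b < a"
      by (cases p rule: initial_depth.cases) (auto split: if_splits)
    then have "p = ?h (a - b, b, q)" "(a - b, b, q) \<in> ?T"
      using that by (auto simp: pos_lists_def)
    then show False using that by blast
  qed
  have "gf sum_list pos_lists (\<lambda>p. of_nat (initial_depth p) :: 'a)
      = gf sum_list (?h ` ?T) (\<lambda>p. of_nat (initial_depth p))"
    by (rule gf_restrict_support[OF graded_pos_lists sub]) (use supp in simp)
  also have "\<dots> = gf (\<lambda>x. sum_list (?h x)) ?T (\<lambda>x. of_nat (initial_depth (?h x)))"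
    by (rule gf_image[OF inj])
  also have "\<dots> = gf (\<lambda>(d, y). 2 * d + (\<lambda>(b, q). 3 * b + sum_list q) y) ?T
      (\<lambda>(d, y). of_nat d * (\<lambda>(b, q). 1 * 1) y)"
    by (rule arg_cong3[where f = gf]) (auto simp: fun_eq_iff)
  also have "\<dots> = gf (\<lambda>d. 2 * d) {0<..} of_nat
      * (gf (\<lambda>b. 3 * b) {0<..} (\<lambda>_. 1) * gf sum_list pos_lists (\<lambda>_. 1))"
    by (simp only: gf_times graded_times graded_multiples graded_pos_lists zero_less_numeral)
  finally show ?thesis .
qed

lemma gf_total_depth_rec:
  "(1 - 2 * fps_X) * gf sum_list pos_lists (\<lambda>p. of_nat (total_depth p))
    = (1 - fps_X) * gf sum_list pos_lists (\<lambda>p. of_nat (initial_depth p))"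
proof -
  let ?D = "gf sum_list pos_lists (\<lambda>p. of_nat (total_depth p)) :: 'a fps"
  let ?H = "gf sum_list pos_lists (\<lambda>p. of_nat (initial_depth p)) :: 'a fps"
  let ?S = "gf (\<lambda>d. d) {0<..} (\<lambda>_. 1) :: 'a fps"
  let ?g = "\<lambda>f. gf (\<lambda>(a, p). a + sum_list p) ({0<..} \<times> pos_lists) f :: 'a fps"
  have "?D = ?g (\<lambda>(a, p). of_nat (total_depth (a # p)))"
    using gf_pos_lists_rec[of "\<lambda>p. of_nat (total_depth p) :: 'a"] by (simp add: total_depth_Nil)
  also have "\<dots> = ?g (\<lambda>x. (\<lambda>(a, p). of_nat (initial_depth (a # p))) x
      + (\<lambda>(a, p). 1 * of_nat (total_depth p)) x)"
    by (rule gf_cong) (auto simp: total_depth_Cons)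
  also have "\<dots> = ?g (\<lambda>(a, p). of_nat (initial_depth (a # p)))
      + ?g (\<lambda>(a, p). 1 * of_nat (total_depth p))"
    by (rule gf_add)
  also have "?g (\<lambda>(a, p). of_nat (initial_depth (a # p))) = ?H"
    using gf_pos_lists_rec[of "\<lambda>p. of_nat (initial_depth p) :: 'a"] by simp
  also have "?g (\<lambda>(a, p). 1 * of_nat (total_depth p)) = ?S * ?D"
    by (rule gf_times[OF graded_positive graded_pos_lists])
  finally have "?D = ?H + ?S * ?D" .
  from solve_first_part_equation[OF this gf_count_parts] show ?thesis by simp
qed

text \<open>The factor $(1-x)^2$ that cancels comes once from each of the two recursions by the first part;
it removes the double root at $1$ that $(1-x^2)^2$ would contribute.\<close>

theorem gf_dsv:
  "(1 + fps_X)\<^sup>2 * (1 - fps_X ^ 3) * (1 - 2 * fps_X)\<^sup>2 * Abs_fps (\<lambda>n. of_nat (dsv n))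
    = (fps_X ^ 5 :: 'a::idom fps)"
proof -
  define D where "D = (gf sum_list pos_lists (\<lambda>p. of_nat (total_depth p)) :: 'a fps)"
  define H where "H = (gf sum_list pos_lists (\<lambda>p. of_nat (initial_depth p)) :: 'a fps)"
  define C where "C = (gf sum_list pos_lists (\<lambda>_. 1) :: 'a fps)"
  define P where "P = (gf (\<lambda>d. 2 * d) {0<..} of_nat :: 'a fps)"
  define Q where "Q = (gf (\<lambda>b. 3 * b) {0<..} (\<lambda>_. 1) :: 'a fps)"
  have D_eq: "Abs_fps (\<lambda>n. of_nat (dsv n)) = D"
    by (simp add: fps_eq_iff D_def gf_nth dsv_def compositions_eq total_depth_def)
  have eqs: "(1 - 2 * fps_X) * D = (1 - fps_X) * H" "H = P * (Q * C)"
    "(1 - 2 * fps_X) * C = 1 - fps_X"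
    "(1 - fps_X\<^sup>2)\<^sup>2 * P = fps_X\<^sup>2" "(1 - fps_X ^ 3) * Q = fps_X ^ 3"
    unfolding D_def H_def C_def P_def Q_def
    by (simp_all add: gf_total_depth_rec gf_initial_depth gf_compositions
        gf_multiples_sum gf_multiples_count)
  let ?L = "(1 + fps_X)\<^sup>2 * (1 - fps_X ^ 3) * (1 - 2 * fps_X)\<^sup>2 * D"
  \<comment> \<open>One factor \<open>1 - 2 * x\<close> turns \<open>D\<close> into \<open>H\<close>; the other one then evaluates \<open>C\<close> inside \<open>H\<close>.\<close>
  have "(1 - fps_X)\<^sup>2 * ?L
      = (1 - fps_X\<^sup>2)\<^sup>2 * (1 - fps_X ^ 3) * (1 - 2 * fps_X) * ((1 - 2 * fps_X) * D)"
    by algebra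
  also have "\<dots> = (1 - fps_X) * ((1 - fps_X\<^sup>2)\<^sup>2 * P) * ((1 - fps_X ^ 3) * Q) * ((1 - 2 * fps_X) * C)"
    by (subst eqs(1), subst eqs(2)) (simp only: mult_ac)
  also have "\<dots> = (1 - fps_X)\<^sup>2 * fps_X ^ 5"
    unfolding eqs by algebra
  finally have "(1 - fps_X)\<^sup>2 * ?L = (1 - fps_X)\<^sup>2 * fps_X ^ 5" .
  moreover have "(1 - fps_X :: 'a fps) \<noteq> 0"
    by (auto simp: fps_eq_iff intro!: exI[of _ 0])
  ultimately show ?thesis unfolding D_eq by simp
qed

section \<open>Partial fractions\<close>

lemma fps_geometric_series:
  "(1 - fps_const c * fps_X) * Abs_fps (\<lambda>n. c ^ n) = (1 :: 'a::comm_ring_1 fps)"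
proof (rule fps_ext)
  show "fps_nth ((1 - fps_const c * fps_X) * Abs_fps (\<lambda>n. c ^ n)) n = fps_nth 1 n" for n
    by (cases n) (simp_all add: algebra_simps)
qed

lemma fps_geometric_series_deriv:
  "(1 - fps_const c * fps_X)\<^sup>2 * Abs_fps (\<lambda>n. of_nat n * c ^ n)
    = (fps_const c * fps_X :: 'a::comm_ring_1 fps)"
proof -
  let ?G = "Abs_fps (\<lambda>n. c ^ n)" and ?N = "Abs_fps (\<lambda>n. of_nat n * c ^ n)"
  have "(1 - fps_const c * fps_X) * ?N = fps_const c * fps_X * ?G"
  proof (rule fps_ext)
    show "fps_nth ((1 - fps_const c * fps_X) * ?N) n = fps_nth (fps_const c * fps_X * ?G) n" for n
      by (cases n) (simp_all add: algebra_simps)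
  qed
  then have "(1 - fps_const c * fps_X)\<^sup>2 * ?N
      = fps_const c * fps_X * ((1 - fps_const c * fps_X) * ?G)"
    by (simp only: power2_eq_square mult_ac)
  then show ?thesis by (simp only: fps_geometric_series mult_1_right)
qed

text \<open>With \<open>w = (s - 1) / 2\<close> the hypothesis gives \<open>(1 + s) * w = - 2\<close>, so \<open>w\<close> is the base of the
exponential on the left, and what remains is an identity between the coefficients.\<close>

lemma cube_root_term:
  fixes s :: complex
  assumes "s\<^sup>2 = - 3"
  shows "(- 33 - 15 * s) * (- 2) ^ n / (441 * (1 + s) ^ (n + 1))
    = (3 * ((s - 1) / 2) - 5) * ((s - 1) / 2) ^ n / 147"
proof -
  define w where "w = (s - 1) / 2"
  have prod: "(1 + s) * w = - 2"
    using assms by (simp add: w_def field_simps power2_eq_square)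
  then have nz: "1 + s \<noteq> 0" by auto
  have coeff: "(3 * w - 5) * 3 * (1 + s) = - 33 - 15 * s"
    using prod by algebra
  have "(- 2) ^ n = (1 + s) ^ n * w ^ n"
    by (simp flip: prod add: power_mult_distrib)
  then have "(- 33 - 15 * s) * (- 2) ^ n / (441 * (1 + s) ^ (n + 1))
      = ((3 * w - 5) * 3 * w ^ n * ((1 + s) * (1 + s) ^ n)) / (441 * ((1 + s) * (1 + s) ^ n))"
    by (simp only: flip: coeff) (simp add: mult_ac)
  also have "\<dots> = (3 * w - 5) * w ^ n / 147"
    using nz by simp
  finally show ?thesis by (simp add: w_def)
qed

text \<open>Both \<open>w\<close> and \<open>v\<close> are roots of \<open>1 + x + x\<^sup>2\<close>, so the sequence satisfies the recurrence with this
characteristic polynomial; the numerator records the two initial values.\<close>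

lemma fps_cube_root_terms:
  fixes w v :: "'a::comm_ring_1"
  assumes "v = - 1 - w" "w\<^sup>2 = - 1 - w"
  shows "(1 + fps_X + fps_X\<^sup>2) * Abs_fps (\<lambda>n. (3 * w - 5) * w ^ n + (3 * v - 5) * v ^ n)
    = - 13 - 11 * fps_X"
proof -
  define u where "u = (\<lambda>n. (3 * w - 5) * w ^ n + (3 * v - 5) * v ^ n)"
  have ww: "w * w = - 1 - w" using assms(2) by (simp add: power2_eq_square)
  have vv: "v * v = - 1 - v"
    by (simp add: assms(1) left_diff_distrib right_diff_distrib ww)
  have u0: "u 0 = - 13" by (simp add: u_def assms(1))
  have "u 1 = 3 * (w * w) - 5 * w + 3 * (v * v) - 5 * v"
    by (simp add: u_def algebra_simps)
  then have u1: "u 1 = 2" unfolding ww vv by (simp add: assms(1))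
  have rec: "u (Suc (Suc n)) + u (Suc n) + u n = 0" for n
  proof -
    have "u (Suc (Suc n)) + u (Suc n) + u n
        = (3 * w - 5) * (w * w + w + 1) * w ^ n + (3 * v - 5) * (v * v + v + 1) * v ^ n"
      by (simp add: u_def algebra_simps)
    then show ?thesis unfolding ww vv by simp
  qed
  have "fps_nth ((1 + fps_X + fps_X\<^sup>2) * Abs_fps u) n = fps_nth (- 13 - 11 * fps_X) n" for n
  proof -
    have lhs: "fps_nth ((1 + fps_X + fps_X\<^sup>2) * Abs_fps u) n
        = u n + (if n = 0 then 0 else u (n - 1)) + (if n < 2 then 0 else u (n - 2))"
      by (simp add: distrib_right fps_X_power_mult_nth)
    consider "n = 0" | "n = 1" | m where "n = Suc (Suc m)"
      by (metis One_nat_def not0_implies_Suc)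
    then show ?thesis
      unfolding lhs using u0 u1 rec
      by cases (simp_all add: numeral_fps_const flip: fps_const_neg)
  qed
  then show ?thesis unfolding u_def by (rule fps_ext)
qed

text \<open>The series \<open>a\<close>, \<dots>, \<open>u\<close> are known only through their denominators, all of which divide the
product on the left. After grouping each series with its own denominator, a polynomial identity
remains. The coefficients are those of the closed formula times 5292.\<close>

lemma partial_fractions:
  fixes x :: "'a::idom"
  assumes "(1 - x) * a = 1" "(1 + x) * b = 1" "(1 - 2 * x) * e = 1"
    and "(1 + x)\<^sup>2 * c = - x" "(1 - 2 * x)\<^sup>2 * d = 2 * x" "(1 + x + x\<^sup>2) * u = - 13 - 11 * x"
  shows "(1 + x)\<^sup>2 * (1 - x ^ 3) * (1 - 2 * x)\<^sup>2
      * (343 * b - 294 * c + 84 * d - 316 * e + 36 * u + 441 * a) = 5292 * x ^ 5"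
proof -
  have "(1 + x)\<^sup>2 * (1 - x ^ 3) * (1 - 2 * x)\<^sup>2
      * (343 * b - 294 * c + 84 * d - 316 * e + 36 * u + 441 * a)
    = 343 * ((1 + x) * b) * (1 + x) * (1 - x ^ 3) * (1 - 2 * x)\<^sup>2
      - 294 * ((1 + x)\<^sup>2 * c) * (1 - x ^ 3) * (1 - 2 * x)\<^sup>2
      + 84 * ((1 - 2 * x)\<^sup>2 * d) * (1 + x)\<^sup>2 * (1 - x ^ 3)
      - 316 * ((1 - 2 * x) * e) * (1 + x)\<^sup>2 * (1 - x ^ 3) * (1 - 2 * x)
      + 36 * ((1 + x + x\<^sup>2) * u) * (1 + x)\<^sup>2 * (1 - x) * (1 - 2 * x)\<^sup>2
      + 441 * ((1 - x) * a) * (1 + x)\<^sup>2 * (1 + x + x\<^sup>2) * (1 - 2 * x)\<^sup>2"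
    by algebra
  also have "\<dots> = 5292 * x ^ 5"
    unfolding assms by algebra
  finally show ?thesis .
qed

theorem corollary7:
  fixes n :: nat
  assumes "n \<ge> 1"
  shows "(of_nat (dsv n) :: complex) =
      ((- 6 * of_nat n + 7) / 108) * (- 1) ^ n
    + ((21 * of_nat n - 79) / 1323) * 2 ^ n
    + ((- 33 - 15 * of_real (sqrt 3) * \<i>) * (- 2) ^ n) / (441 * (1 + \<i> * of_real (sqrt 3)) ^ (n + 1))
    + ((- 33 + 15 * of_real (sqrt 3) * \<i>) * (- 2) ^ n) / (441 * (1 - \<i> * of_real (sqrt 3)) ^ (n + 1))
    + 1 / 12"
proof -
  define s where "s = \<i> * complex_of_real (sqrt 3)"
  define w where "w = (s - 1) / 2"
  define v where "v = (- s - 1) / 2"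
  have s2: "s\<^sup>2 = - 3" "(- s)\<^sup>2 = - 3"
    by (simp_all add: s_def power_mult_distrib flip: of_real_power)
  have roots: "v = - 1 - w" "w\<^sup>2 = - 1 - w"
    using s2 by (simp_all add: v_def w_def field_simps power2_eq_square)
  \<comment> \<open>The conjugate terms, scaled by 147.\<close>
  define U where "U = Abs_fps (\<lambda>n. (3 * w - 5) * w ^ n + (3 * v - 5) * v ^ n)"
  define A where "A = Abs_fps (\<lambda>n. 1 ^ n :: complex)"
  define B where "B = Abs_fps (\<lambda>n. (- 1) ^ n :: complex)"
  define C where "C = Abs_fps (\<lambda>n. of_nat n * (- 1) ^ n :: complex)"
  define D where "D = Abs_fps (\<lambda>n. of_nat n * 2 ^ n :: complex)"
  define E where "E = Abs_fps (\<lambda>n. 2 ^ n :: complex)"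
  define K where "K = 343 * B - 294 * C + 84 * D - 316 * E + 36 * U + 441 * A"
  define S where "S = Abs_fps (\<lambda>n. of_nat (dsv n) :: complex)"
  define L where "L = (1 + fps_X)\<^sup>2 * (1 - fps_X ^ 3) * (1 - 2 * fps_X :: complex fps)\<^sup>2"
  have const: "fps_const (- 1 :: complex) = - 1" "fps_const (2 :: complex) = 2"
    by (simp_all add: numeral_fps_const flip: fps_const_neg)
  have LK: "L * K = 5292 * fps_X ^ 5"
    unfolding L_def K_def
  proof (rule partial_fractions)
    show "(1 + fps_X + fps_X\<^sup>2) * U = - 13 - 11 * fps_X"
      unfolding U_def by (rule fps_cube_root_terms[OF roots])
  qed (use fps_geometric_series[of "1 :: complex"] fps_geometric_series[of "- 1 :: complex"]
      fps_geometric_series[of "2 :: complex"] fps_geometric_series_deriv[of "- 1 :: complex"]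
      fps_geometric_series_deriv[of "2 :: complex"]
      in \<open>simp_all add: A_def B_def C_def D_def E_def const\<close>)
  have "L * (5292 * S) = 5292 * (L * S)" by (simp only: mult_ac)
  also have "\<dots> = L * K" unfolding LK unfolding L_def S_def gf_dsv ..
  finally have "L * (5292 * S) = L * K" .
  moreover have "fps_nth L 0 = 1" by (simp add: L_def fps_power_zeroth)
  then have "L \<noteq> 0" by auto
  ultimately have "5292 * S = K" by simp
  then have "fps_nth (5292 * S) n = fps_nth K n" by simp
  then have "of_nat (dsv n) = (343 * (- 1) ^ n - 294 * (of_nat n * (- 1) ^ n)
      + 84 * (of_nat n * 2 ^ n) - 316 * 2 ^ n
      + 36 * ((3 * w - 5) * w ^ n + (3 * v - 5) * v ^ n) + 441) / 5292"
    by (simp add: eq_divide_eq mult.commute[of _ 5292]) (simp add: K_def S_def A_def B_def C_def D_def E_def U_def numeral_fps_const)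
  also have "\<dots> = ((- 6 * of_nat n + 7) / 108) * (- 1) ^ n
      + ((21 * of_nat n - 79) / 1323) * 2 ^ n
      + (3 * w - 5) * w ^ n / 147 + (3 * v - 5) * v ^ n / 147 + 1 / 12"
    by (simp add: field_simps)
  also have "(3 * w - 5) * w ^ n / 147 = (- 33 - 15 * s) * (- 2) ^ n / (441 * (1 + s) ^ (n + 1))"
    unfolding w_def by (rule cube_root_term[OF s2(1), symmetric])
  also have "(3 * v - 5) * v ^ n / 147 = (- 33 + 15 * s) * (- 2) ^ n / (441 * (1 - s) ^ (n + 1))"
    using cube_root_term[OF s2(2), of n] by (simp add: v_def)
  finally show ?thesis by (simp add: s_def mult_ac)
qed

end
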